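(* Let $n\ge 2$ and let $A=\{a_1=0,a_2,\dots,a_n\}$ be a set of integers with $0=a_1<a_2<\cdots<a_n$ and $\gcd(a_2,\dots,a_n)=1$. The following conditions are equivalent: (1) there is an arithmetic function $o(s)$ with $\lim_{s\to\infty}o(s)=0$ such that $|sA|=s(n-1)+1+o(s)$ for infinitely many $s$; (2) $|sA|=s(n-1)+1$ for all $s\gg 0$; (3) $|sA|=s(n-1)+1$ for some $s\ge 2$; (4) $A=\{0,1,\dots,n-1\}$; (5) $|sA|=s(n-1)+1$ for all $s\ge 0$.
   Context: For an integer $s\ge 1$, the $s$-fold iterated sumset of $A$ is $sA=\{a_{i_1}+\cdots+a_{i_s}\mid 1\le i_1\le\cdots\le i_s\le n\}$, and $0A=\{0\}$. $|sA|$ denotes cardinality. An arithmetic function is a function defined on the non-negative (or positive) integers with real values. *)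

theory Defs
  imports Complex_Main
begin

(* Sums of s elements of A, repetitions allowed. Each summand list is taken in weakly increasing
   order; when A is listed increasingly as a_1 < ... < a_n this is the index condition
   i_1 <= ... <= i_s. For s = 0 only the empty list occurs, so the 0-fold sumset is {0}. *)
definition iterated_sumset :: "nat \<Rightarrow> int set \<Rightarrow> int set" where
  "iterated_sumset s A = {sum_list xs | xs. length xs = s \<and> set xs \<subseteq> A \<and> sorted xs}"

end

theory Submission
  imports Defs "HOL-Library.Infinite_Set" "HOL-Library.Multiset"
begin

text \<open>
  Translating all of \<open>sA\<close> by \<open>min A = 0\<close> and the maximum of \<open>sA\<close> by all of \<open>A\<close> shows
  \<open>|(s+1)A| \<ge> |sA| + n - 1\<close>. Hence \<open>|sA| = s(n-1) + 1\<close> for a single \<open>s \<ge> 2\<close> forces \<open>|2A| = 2n - 1\<close>,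
  so that \<open>2A\<close> consists only of the chain
  \<open>a\<^sub>1 + a\<^sub>1 < a\<^sub>1 + a\<^sub>2 < a\<^sub>2 + a\<^sub>2 < a\<^sub>2 + a\<^sub>3 < \<dots> < a\<^sub>n + a\<^sub>n\<close>. The sum \<open>a\<^sub>i + a\<^sub>i\<^sub>+\<^sub>2\<close> lies strictly between
  \<open>a\<^sub>i + a\<^sub>i\<^sub>+\<^sub>1\<close> and \<open>a\<^sub>i\<^sub>+\<^sub>1 + a\<^sub>i\<^sub>+\<^sub>2\<close>, so it equals \<open>2a\<^sub>i\<^sub>+\<^sub>1\<close>; thus \<open>A\<close> is an arithmetic progression,
  whose difference is 1 by the gcd condition. Condition (1) yields such an \<open>s\<close> because the error
  term is an integer for infinitely many \<open>s\<close> and tends to 0.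
\<close>

text \<open>Sorting a list changes neither its sum nor its entries. Without the order condition a
  summand can be put in front freely, which gives the recursion in \<open>s\<close>.\<close>

lemma iterated_sumset_unsorted:
  "iterated_sumset s A = {sum_list xs | xs. length xs = s \<and> set xs \<subseteq> A}"
proof -
  have "\<exists>ys. sum_list xs = sum_list ys \<and> length ys = length xs \<and> set ys \<subseteq> A \<and> sorted ys"
    if "set xs \<subseteq> A" for xs :: "int list"
    using that by (intro exI[of _ "sort xs"]) (simp flip: sum_mset_sum_list)
  then show ?thesis
    unfolding iterated_sumset_def by blast
qed

lemma iterated_sumset_0 [simp]: "iterated_sumset 0 A = {0}"
  by (auto simp: iterated_sumset_unsorted)

lemma iterated_sumset_Suc:
  "iterated_sumset (Suc s) A = (\<lambda>(x, y). x + y) ` (A \<times> iterated_sumset s A)"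
proof (intro equalityI subsetI)
  fix z assume "z \<in> iterated_sumset (Suc s) A"
  then obtain x xs where "z = x + sum_list xs" "x \<in> A" "length xs = s" "set xs \<subseteq> A"
    by (auto simp: iterated_sumset_unsorted length_Suc_conv)
  then show "z \<in> (\<lambda>(x, y). x + y) ` (A \<times> iterated_sumset s A)"
    by (intro image_eqI[of _ _ "(x, sum_list xs)"]) (auto simp: iterated_sumset_unsorted)
next
  fix z assume "z \<in> (\<lambda>(x, y). x + y) ` (A \<times> iterated_sumset s A)"
  then obtain x xs where "z = sum_list (x # xs)" "length (x # xs) = Suc s" "set (x # xs) \<subseteq> A"
    by (auto simp: iterated_sumset_unsorted)
  then show "z \<in> iterated_sumset (Suc s) A"
    unfolding iterated_sumset_unsorted by blast
qed

lemma finite_iterated_sumset: "finite A \<Longrightarrow> finite (iterated_sumset s A)"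
  by (induction s) (simp_all add: iterated_sumset_Suc)

lemma iterated_sumset_nonempty: "A \<noteq> {} \<Longrightarrow> iterated_sumset s A \<noteq> {}"
  by (induction s) (simp_all add: iterated_sumset_Suc)

lemma add_mem_iterated_sumset_2:
  "x \<in> A \<Longrightarrow> y \<in> A \<Longrightarrow> x + y \<in> iterated_sumset 2 A"
  unfolding iterated_sumset_unsorted by (intro CollectI exI[of _ "[x, y]"]) simp

lemma card_sumset_ge:
  fixes A B :: "int set"
  assumes "finite A" "finite B" "B \<noteq> {}" "0 \<in> A" "\<And>x. x \<in> A \<Longrightarrow> 0 \<le> x"
  shows "card B + (card A - 1) \<le> card ((\<lambda>(x, y). x + y) ` (A \<times> B))"
proof -
  \<comment> \<open>Removing 0 makes every element of \<open>?T\<close> exceed \<open>Max B\<close>,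
    so \<open>?T\<close> is disjoint from \<open>B\<close>, which itself lies in the sumset as 0 +
    \<open>B\<close>.\<close>
  let ?T = "(\<lambda>x. x + Max B) ` (A - {0})"
  have disj: "B \<inter> ?T = {}"
  proof -
    have False if "x \<in> A" "x \<noteq> 0" "x + Max B \<in> B" for x
      using Max_ge[OF assms(2) that(3)] assms(5)[OF that(1)] that(2) by linarith
    then show ?thesis by blast
  qed
  have "card B + (card A - 1) = card (B \<union> ?T)"
    using assms disj by (simp add: card_Un_disjoint card_image)
  also have "\<dots> \<le> card ((\<lambda>(x, y). x + y) ` (A \<times> B))"
  proof (rule card_mono)
    have "b \<in> (\<lambda>(x, y). x + y) ` (A \<times> B)" if "b \<in> B" for b
      using assms(4) that by (force intro: image_eqI[of _ _ "(0, b)"])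
    moreover have "x + Max B \<in> (\<lambda>(x, y). x + y) ` (A \<times> B)" if "x \<in> A" for x
      using that Max_in[OF assms(2,3)] by (force intro: image_eqI[of _ _ "(x, Max B)"])
    ultimately show "B \<union> ?T \<subseteq> (\<lambda>(x, y). x + y) ` (A \<times> B)" by blast
  qed (use assms in simp)
  finally show ?thesis .
qed

lemma card_iterated_sumset_add_ge:
  assumes "finite A" "0 \<in> A" "\<And>x. x \<in> A \<Longrightarrow> 0 \<le> x"
  shows "card (iterated_sumset s A) + k * (card A - 1) \<le> card (iterated_sumset (s + k) A)"
proof (induction k)
  case (Suc k)
  have "card (iterated_sumset (s + k) A) + (card A - 1) \<le> card (iterated_sumset (Suc (s + k)) A)"
    unfolding iterated_sumset_Suc
    using assms by (intro card_sumset_ge finite_iterated_sumset iterated_sumset_nonempty) auto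
  with Suc show ?case by simp
qed simp

lemma iterated_sumset_atLeastAtMost:
  assumes "0 \<le> m"
  shows "iterated_sumset s {0..m} = {0..int s * m}"
proof (induction s)
  case (Suc s)
  have "(\<lambda>(x, y). x + y) ` ({0..m} \<times> {0..int s * m}) = {0..int (Suc s) * m}"
  proof (intro equalityI subsetI)
    fix z assume z: "z \<in> {0..int (Suc s) * m}"
    \<comment> \<open>Greedy splitting: the first summand takes as much of \<open>z\<close> as it
      can, so the rest is either 0 or \<open>z - m\<close>, which is at most
      \<open>s * m\<close>.\<close>
    have "z = min z m + (z - min z m)" by simp
    moreover have "min z m \<in> {0..m}" "z - min z m \<in> {0..int s * m}"
      using z assms by (auto simp: min_def algebra_simps)
    ultimately show "z \<in> (\<lambda>(x, y). x + y) ` ({0..m} \<times> {0..int s * m})"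
      by (intro image_eqI[of _ _ "(min z m, z - min z m)"]) auto
  qed (auto simp: algebra_simps)
  then show ?case by (simp only: iterated_sumset_Suc Suc.IH)
qed simp

lemma arith_progression_of_card_iterated_sumset_2:
  fixes a :: "nat \<Rightarrow> int"
  assumes mono: "strict_mono_on {1..n} a" and A: "A = a ` {1..n}"
    and card: "card (iterated_sumset 2 A) = 2 * (n - 1) + 1"
    and i: "1 \<le> i" "i + 2 \<le> n"
  shows "a i + a (i + 2) = 2 * a (i + 1)"
proof -
  \<comment> \<open>\<open>f\<close> enumerates the chain from 0: \<open>f (2 * d)\<close> is the
    double of \<open>a (d + 1)\<close>, and \<open>f (2 * d + 1)\<close> is
    \<open>a (d + 1) + a (d + 2)\<close>. The two indices advance alternately.\<close>
  define f where "f k = a (1 + k div 2) + a (1 + (k + 1) div 2)" for k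
  have a_less: "a x < a y" if "1 \<le> x" "x < y" "y \<le> n" for x y
    using strict_mono_onD[OF mono] that by simp
  have a_le: "a x \<le> a y" if "1 \<le> x" "x \<le> y" "y \<le> n" for x y
    using a_less[of x y] that by (cases "x = y") auto
  have f_less: "f j < f k" if "j < k" "k \<le> 2 * (n - 1)" for j k
  \<comment> \<open>Either the first index grows and the second does not drop, or \<open>j\<close>
    is even with \<open>k = j + 1\<close> and only the second index grows.\<close>
  proof (cases "j div 2 < k div 2")
    case True
    then have "a (1 + j div 2) < a (1 + k div 2)" using that i by (intro a_less; linarith)
    moreover have "a (1 + (j + 1) div 2) \<le> a (1 + (k + 1) div 2)"
      using that i by (intro a_le; linarith)
    ultimately show ?thesis by (simp add: f_def)
  next
    case False
    with that(1) have "j = 2 * (j div 2)" "k = 2 * (j div 2) + 1" by linarith+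
    then obtain d where "j = 2 * d" "k = 2 * d + 1" by blast
    then have "j div 2 = k div 2" "(j + 1) div 2 < (k + 1) div 2" by simp_all
    moreover from this have "a (1 + (j + 1) div 2) < a (1 + (k + 1) div 2)"
      using that i by (intro a_less; linarith)
    ultimately show ?thesis by (simp add: f_def)
  qed
  have inj: "inj_on f {..2 * (n - 1)}"
    using f_less by (intro linorder_inj_onI) force+
  have sub: "f ` {..2 * (n - 1)} \<subseteq> iterated_sumset 2 A"
    using i by (auto simp: f_def A intro!: add_mem_iterated_sumset_2 imageI)
  \<comment> \<open>The chain has 2(n - 1) + 1 distinct members, as many as the double sumset, so it
    exhausts it.\<close>
  have "f ` {..2 * (n - 1)} = iterated_sumset 2 A"
    using sub inj card by (intro card_subset_eq) (auto simp: card_image A finite_iterated_sumset)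
  moreover have "a i + a (i + 2) \<in> iterated_sumset 2 A"
    using i by (auto simp: A intro!: add_mem_iterated_sumset_2)
  ultimately obtain k where k: "k \<le> 2 * (n - 1)" "a i + a (i + 2) = f k" by auto
  have f_odd: "f (2 * i - 1) = a i + a (i + 1)" "f (2 * i + 1) = a (i + 1) + a (i + 2)"
    and f_even: "f (2 * i) = 2 * a (i + 1)"
  proof -
    have "(2 * i - 1) div 2 = i - 1" "(2 * i - 1 + 1) div 2 = i" using i by auto
    then show "f (2 * i - 1) = a i + a (i + 1)" unfolding f_def using i by simp
  qed (simp_all add: f_def)
  \<comment> \<open>Since \<open>f\<close> is increasing, these bounds leave \<open>2 * i\<close> as
    the only possible position of \<open>k\<close>.\<close>
  have between: "f (2 * i - 1) < f k" "f k < f (2 * i + 1)"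
    using a_less[of "i + 1" "i + 2"] a_less[of i "i + 1"] i k(2) unfolding f_odd by simp_all
  have "\<not> k < 2 * i - 1" "\<not> 2 * i + 1 < k"
    using f_less[of k "2 * i - 1"] f_less[of "2 * i + 1" k] between i k(1) by linarith+
  moreover have "k \<noteq> 2 * i - 1" "k \<noteq> 2 * i + 1" using between by auto
  ultimately have "k = 2 * i" by linarith
  with k f_even show ?thesis by simp
qed

lemma eq_atLeastAtMost_of_arith_progression:
  fixes a :: "nat \<Rightarrow> int"
  assumes n: "n \<ge> 2" and a1: "a 1 = 0" and mono: "strict_mono_on {1..n} a"
    and gcd: "Gcd (a ` {2..n}) = 1"
    and ap: "\<And>i. 1 \<le> i \<Longrightarrow> i + 2 \<le> n \<Longrightarrow> a i + a (i + 2) = 2 * a (i + 1)"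
  shows "a ` {1..n} = {0..int n - 1}"
proof -
  \<comment> \<open>The recurrence \<open>ap\<close> is of second order, hence strong induction with
    two base cases; the shift by one makes the value at \<open>i = 0\<close> the given
    \<open>a 1 = 0\<close>.\<close>
  have a_eq: "Suc i \<le> n \<Longrightarrow> a (Suc i) = int i * a 2" for i
  proof (induction i rule: less_induct)
    case (less i)
    consider "i = 0" | "i = 1" | j where "i = Suc (Suc j)"
      by (metis One_nat_def not0_implies_Suc)
    then show ?case
    proof cases
      case 3
      have "a (Suc j) = int j * a 2" "a (Suc (Suc j)) = int (Suc j) * a 2"
        using less 3 by simp_all
      moreover have "a (Suc j) + a (Suc (Suc (Suc j))) = 2 * a (Suc (Suc j))"
        using ap[of "Suc j"] less.prems 3 by simp
      ultimately show ?thesis using 3 by (simp add: algebra_simps)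
    qed (use a1 in \<open>simp_all add: numeral_2_eq_2\<close>)
  qed
  have "a 2 dvd a k" if "k \<in> {2..n}" for k
    using a_eq[of "k - 1"] that by simp
  then have "a 2 dvd Gcd (a ` {2..n})" by (intro Gcd_greatest) auto
  moreover have "0 < a 2" using strict_mono_onD[OF mono, of 1 2] a1 n by simp
  ultimately have "a 2 = 1" using gcd by simp
  then have a_val: "a k = int k - 1" if "k \<in> {1..n}" for k
    using a_eq[of "k - 1"] that by simp
  have "x \<in> a ` {1..n}" if "x \<in> {0..int n - 1}" for x
  proof
    show "nat (x + 1) \<in> {1..n}" using that by auto
    then show "x = a (nat (x + 1))" using that a_val by auto
  qed
  then show ?thesis using a_val by auto
qed

text \<open>Integers at distance less than 1 coincide, and the error reaches absolute value 1 for
  only finitely many \<open>s\<close>. Discarding these from an infinite set leaves infinitely many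
  equalities.\<close>

lemma infinite_eq_of_int_error:
  fixes f g :: "nat \<Rightarrow> int"
  assumes "err \<longlonglongrightarrow> (0 :: real)" and "infinite {s. real_of_int (f s) = real_of_int (g s) + err s}"
  shows "infinite {s. f s = g s}"
proof
  assume fin: "finite {s. f s = g s}"
  have "\<forall>\<^sub>F s in sequentially. \<bar>err s\<bar> < 1"
    using tendstoD[OF assms(1), of 1] by simp
  then have "finite {s. \<not> \<bar>err s\<bar> < 1}"
    by (simp add: eventually_cofinite cofinite_eq_sequentially[symmetric])
  moreover have "{s. real_of_int (f s) = real_of_int (g s) + err s}
      \<subseteq> {s. f s = g s} \<union> {s. \<not> \<bar>err s\<bar> < 1}"
  proof -
    have "f s = g s" if "real_of_int (f s) = real_of_int (g s) + err s" "\<bar>err s\<bar> < 1" for s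
      using that by linarith
    then show ?thesis by blast
  qed
  ultimately show False using fin assms(2) by (meson finite_UnI finite_subset)
qed

theorem theorem4p3:
  fixes n :: nat and a :: "nat \<Rightarrow> int" and A :: "int set"
  assumes "n \<ge> 2"
    and "A = a ` {1..n}"
    and "a 1 = 0"
    and "strict_mono_on {1..n} a"
    and "Gcd (a ` {2..n}) = 1"
  shows
    "let C1 = (\<exists>err :: nat \<Rightarrow> real. err \<longlonglongrightarrow> 0 \<and>
                 infinite {s. real (card (iterated_sumset s A)) = real s * (real n - 1) + 1 + err s});
         C2 = (\<forall>\<^sub>F s in sequentially. card (iterated_sumset s A) = s * (n - 1) + 1);
         C3 = (\<exists>s\<ge>2. card (iterated_sumset s A) = s * (n - 1) + 1);
         C4 = (A = {0..int n - 1});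
         C5 = (\<forall>s. card (iterated_sumset s A) = s * (n - 1) + 1)
     in (C1 \<longleftrightarrow> C2) \<and> (C2 \<longleftrightarrow> C3) \<and> (C3 \<longleftrightarrow> C4) \<and> (C4 \<longleftrightarrow> C5)"
proof -
  define P where "P s \<longleftrightarrow> card (iterated_sumset s A) = s * (n - 1) + 1" for s
  define C1 where "C1 \<longleftrightarrow> (\<exists>err :: nat \<Rightarrow> real. err \<longlonglongrightarrow> 0 \<and>
      infinite {s. real (card (iterated_sumset s A)) = real s * (real n - 1) + 1 + err s})"
  have inj: "inj_on a {1..n}" using assms(4) by (rule strict_mono_on_imp_inj_on)
  have fin: "finite A" and card_A: "card A = n" and zero: "0 \<in> A"
    using assms(1-3) card_image[OF inj] by (auto simp: image_iff intro!: bexI[of _ 1])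
  have nonneg: "0 \<le> x" if "x \<in> A" for x
  proof -
    from that assms(2) obtain i where i: "i \<in> {1..n}" "x = a i" by blast
    then show ?thesis
      using strict_mono_onD[OF assms(4), of 1 i] assms(3) by (cases "i = 1") auto
  qed
  have C34: "A = {0..int n - 1}" if "\<exists>s\<ge>2. P s"
  proof -
    from that obtain s where s: "s \<ge> 2" "P s" by blast
    \<comment> \<open>Each of the \<open>s - 2\<close> steps from 2 to \<open>s\<close> adds at
      least \<open>n - 1\<close> elements, so any excess at 2 would persist at
      \<open>s\<close>.\<close>
    have "card (iterated_sumset 2 A) + (s - 2) * (n - 1) \<le> s * (n - 1) + 1"
      using card_iterated_sumset_add_ge[OF fin zero nonneg, of 2 "s - 2"] s card_A
      unfolding P_def by (simp only: le_add_diff_inverse)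
    moreover have "s * (n - 1) = (s - 2) * (n - 1) + 2 * (n - 1)"
      using s by (simp only: le_add_diff_inverse2 flip: add_mult_distrib)
    ultimately have "card (iterated_sumset 2 A) \<le> 2 * (n - 1) + 1" by linarith
    \<comment> \<open>Two growth steps starting from the 0-fold sumset, which has one
      element.\<close>
    moreover have "2 * (n - 1) + 1 \<le> card (iterated_sumset 2 A)"
      using card_iterated_sumset_add_ge[OF fin zero nonneg, of 0 2] card_A by (simp add: eval_nat_numeral)
    ultimately have "card (iterated_sumset 2 A) = 2 * (n - 1) + 1" by linarith
    from eq_atLeastAtMost_of_arith_progression[OF assms(1,3,4,5)
        arith_progression_of_card_iterated_sumset_2[OF assms(4,2) this]]
    show ?thesis by (simp add: assms(2))
  qed
  have C45: "\<forall>s. P s" if "A = {0..int n - 1}"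
  proof
    fix s
    have "card (iterated_sumset s A) = nat (int s * (int n - 1) + 1)"
      using assms(1) that by (simp add: iterated_sumset_atLeastAtMost)
    also have "int s * (int n - 1) + 1 = int (s * (n - 1) + 1)"
      using assms(1) by simp
    finally show "P s" unfolding P_def by (simp only: nat_int)
  qed
  have C13: "\<exists>s\<ge>2. P s" if C1
  proof -
    from that obtain err :: "nat \<Rightarrow> real" where err: "err \<longlonglongrightarrow> 0"
      and inf: "infinite {s. real (card (iterated_sumset s A)) = real s * (real n - 1) + 1 + err s}"
      unfolding C1_def by blast
    have "infinite {s. int (card (iterated_sumset s A)) = int (s * (n - 1) + 1)}"
      using err
    proof (rule infinite_eq_of_int_error)
      show "infinite {s. real_of_int (int (card (iterated_sumset s A)))
          = real_of_int (int (s * (n - 1) + 1)) + err s}"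
        using inf assms(1) by (simp add: add.commute)
    qed
    then have "infinite {s. P s}" unfolding P_def by (simp only: of_nat_eq_iff not_False_eq_True)
    \<comment> \<open>An infinite set of naturals has a member that is at least 2.\<close>
    then show ?thesis unfolding infinite_nat_iff_unbounded_le mem_Collect_eq by blast
  qed
  have C51: C1 if "\<forall>s. P s"
    unfolding C1_def using that assms(1) by (intro exI[of _ "\<lambda>_. 0"]) (simp add: P_def)
  have C23: "\<exists>s\<ge>2. P s" if "\<forall>\<^sub>F s in sequentially. P s"
    using that unfolding eventually_sequentially by (meson max.cobounded1 max.cobounded2)
  have C52: "\<forall>\<^sub>F s in sequentially. P s" if "\<forall>s. P s"
    using that by simp
  \<comment> \<open>The implications form the cycle (1), (3), (4), (5), (1), and (2) joins it
    through (5) to (2) and (2) to (3).\<close>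
  show ?thesis
    unfolding Let_def P_def[symmetric] C1_def[symmetric]
    using C13 C23 C34 C45 C51 C52 by argo
qed

end
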